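(* There is an algorithm that, given a context-free grammar $\Gamma$ generating a 0-1-symmetric language $L\subseteq\{0,1\}^*$, decides whether the graph class $\mathcal{G}_L$ has bounded treewidth (i.e., whether there is $k$ such that every graph in $\mathcal{G}_L$ has treewidth at most $k$), and likewise decides whether $\mathcal{G}_L$ has bounded degeneracy (i.e., whether there is $d$ such that every graph in $\mathcal{G}_L$ is $d$-degenerate).
   Context: All graphs are finite, simple, undirected, with nonempty vertex sets, and graph classes are considered up to isomorphism. A graph is $d$-degenerate if every subgraph has a vertex of degree at most $d$. For $w\in\{0,1\}^*$ let $\widetilde{w}$ be obtained from $w$ by exchanging the letters 0 and 1; a language $L\subseteq\{0,1\}^*$ is 0-1-symmetric if $L=\{\widetilde w : w\in L\}$. For an alphabet $V$ and distinct $u,v\in V$, $h_{u,v}:V^*\to\{0,1\}^*$ is the monoid morphism with $u\mapsto 0$, $v\mapsto 1$ and $x\mapsto\lambda$ (empty word) for all other letters $x$. For a 0-1-symmetric $L$ and a nonempty word $w$ whose set of occurring letters is $V$, $G(L,w)$ is the graph with vertex set $V$ in which distinct $u,v$ are adjacent iff $h_{u,v}(w)\in L$. A graph is $L$-representable if it is isomorphic to some $G(L,w)$, and $\mathcal{G}_L$ denotes the class of all $L$-representable graphs. *)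

theory Defs
  imports Main "HOL-Library.Nat_Bijection"
begin

section \<open>Finite simple graphs\<close>

datatype 'a graph = Graph (verts: "'a set") (edges: "'a set set")

definition simple_graph :: "'a graph \<Rightarrow> bool" where
  "simple_graph G \<longleftrightarrow> finite (verts G) \<and> verts G \<noteq> {} \<and>
     (\<forall>e\<in>edges G. e \<subseteq> verts G \<and> card e = 2)"

definition graph_iso :: "'a graph \<Rightarrow> 'b graph \<Rightarrow> bool" where
  "graph_iso G H \<longleftrightarrow>
     (\<exists>f. bij_betw f (verts G) (verts H) \<and> edges H = (\<lambda>e. f ` e) ` edges G)"

definition subgraph :: "'a graph \<Rightarrow> 'a graph \<Rightarrow> bool" where
  "subgraph H G \<longleftrightarrow> simple_graph H \<and> verts H \<subseteq> verts G \<and> edges H \<subseteq> edges G"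

definition induced :: "'a graph \<Rightarrow> 'a set \<Rightarrow> 'a graph" where
  "induced G S = Graph (verts G \<inter> S) {e \<in> edges G. e \<subseteq> S}"

definition degree :: "'a graph \<Rightarrow> 'a \<Rightarrow> nat" where
  "degree G v = card {u \<in> verts G. {u, v} \<in> edges G}"

definition degenerate :: "nat \<Rightarrow> 'a graph \<Rightarrow> bool" where
  "degenerate d G \<longleftrightarrow> (\<forall>H. subgraph H G \<longrightarrow> (\<exists>v\<in>verts H. degree H v \<le> d))"

definition connected :: "'a graph \<Rightarrow> bool" where
  "connected G \<longleftrightarrow>
     (\<forall>u\<in>verts G. \<forall>v\<in>verts G. (u, v) \<in> {(x, y). {x, y} \<in> edges G}\<^sup>*)"

definition is_cycle :: "'a graph \<Rightarrow> 'a list \<Rightarrow> bool" where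
  "is_cycle G c \<longleftrightarrow> length c \<ge> 3 \<and> distinct c \<and>
     (\<forall>i<length c. {c ! i, c ! (Suc i mod length c)} \<in> edges G)"

definition is_tree :: "'a graph \<Rightarrow> bool" where
  "is_tree T \<longleftrightarrow> simple_graph T \<and> connected T \<and> (\<nexists>c. is_cycle T c)"

section \<open>Treewidth\<close>

definition tree_decomposition :: "'a graph \<Rightarrow> 't graph \<Rightarrow> ('t \<Rightarrow> 'a set) \<Rightarrow> bool" where
  "tree_decomposition G T B \<longleftrightarrow> is_tree T \<and>
     (\<Union>t\<in>verts T. B t) = verts G \<and>
     (\<forall>e\<in>edges G. \<exists>t\<in>verts T. e \<subseteq> B t) \<and>
     (\<forall>v\<in>verts G. connected (induced T {t. v \<in> B t}))"

text \<open>For graphs with a nonempty vertex set some bag is nonempty, so the truncated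
  subtraction is harmless.\<close>

definition width :: "'t graph \<Rightarrow> ('t \<Rightarrow> 'a set) \<Rightarrow> nat" where
  "width T B = Max ((\<lambda>t. card (B t)) ` verts T) - 1"

text \<open>Decomposition trees are finite, so their nodes may be taken to be natural numbers.\<close>

definition treewidth :: "'a graph \<Rightarrow> nat" where
  "treewidth G =
     (LEAST k. \<exists>(T :: nat graph) B. tree_decomposition G T B \<and> width T B = k)"

section \<open>Graphs represented by words\<close>

text \<open>Words over \<open>{0,1}\<close> are Boolean lists; \<open>False\<close> is the letter 0, \<open>True\<close> the letter 1.\<close>

definition zero_one_symmetric :: "bool list set \<Rightarrow> bool" where
  "zero_one_symmetric L \<longleftrightarrow> L = map Not ` L"

definition hproj :: "'a \<Rightarrow> 'a \<Rightarrow> 'a list \<Rightarrow> bool list" where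
  "hproj u v w = concat (map (\<lambda>x. if x = u then [False] else if x = v then [True] else []) w)"

definition word_graph :: "bool list set \<Rightarrow> 'a list \<Rightarrow> 'a graph" where
  "word_graph L w = Graph (set w)
     {{u, v} | u v. u \<in> set w \<and> v \<in> set w \<and> u \<noteq> v \<and> hproj u v w \<in> L}"

text \<open>A word uses finitely many letters, so letters may be taken to be natural numbers.\<close>

definition representable :: "bool list set \<Rightarrow> 'a graph \<Rightarrow> bool" where
  "representable L G \<longleftrightarrow> (\<exists>w :: nat list. w \<noteq> [] \<and> graph_iso G (word_graph L w))"

text \<open>Graph classes are considered up to isomorphism and all graphs are finite, so
  graphs on natural numbers exhaust the class.\<close>

definition graph_class :: "bool list set \<Rightarrow> nat graph set" where
  "graph_class L = {G. simple_graph G \<and> representable L G}"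

definition bounded_treewidth :: "'a graph set \<Rightarrow> bool" where
  "bounded_treewidth \<C> \<longleftrightarrow> (\<exists>k. \<forall>G\<in>\<C>. treewidth G \<le> k)"

definition bounded_degeneracy :: "'a graph set \<Rightarrow> bool" where
  "bounded_degeneracy \<C> \<longleftrightarrow> (\<exists>d. \<forall>G\<in>\<C>. degenerate d G)"

section \<open>Context-free grammars over \<open>{0,1}\<close>\<close>

text \<open>Nonterminals are named by natural numbers; the (finite) set of nonterminals is implicit:
  the start symbol together with those occurring in the productions.\<close>

datatype symbol = Tm bool | Nt nat

datatype cfg = CFG (start: nat) (prods: "(nat \<times> symbol list) list")

inductive derives1 :: "cfg \<Rightarrow> symbol list \<Rightarrow> symbol list \<Rightarrow> bool" for \<Gamma> where
  "(A, \<alpha>) \<in> set (prods \<Gamma>) \<Longrightarrow> derives1 \<Gamma> (\<beta> @ [Nt A] @ \<gamma>) (\<beta> @ \<alpha> @ \<gamma>)"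

definition lang :: "cfg \<Rightarrow> bool list set" where
  "lang \<Gamma> = {w. (derives1 \<Gamma>)\<^sup>*\<^sup>* [Nt (start \<Gamma>)] (map Tm w)}"

section \<open>Algorithms\<close>

text \<open>Algorithms are modelled by partial recursive functions: \<open>run\<close> gives the value on
  an argument tuple, with \<open>None\<close> for divergence (or wrong arity). \<open>Mu f\<close> is unbounded
  minimization, which diverges if \<open>f\<close> diverges before the first zero.\<close>

datatype recf = Zero | Succ | Proj nat | Comp recf "recf list" | Prim recf recf | Mu recf

fun run :: "recf \<Rightarrow> nat list \<Rightarrow> nat option" where
  "run Zero xs = Some 0"
| "run Succ xs = (case xs of [x] \<Rightarrow> Some (Suc x) | _ \<Rightarrow> None)"
| "run (Proj i) xs = (if i < length xs then Some (xs ! i) else None)"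
| "run (Comp f gs) xs =
     (let rs = map (\<lambda>g. run g xs) gs
      in if None \<in> set rs then None else run f (map the rs))"
| "run (Prim f g) xs =
     (case xs of [] \<Rightarrow> None
      | n # ys \<Rightarrow> rec_nat (run f ys)
          (\<lambda>m r. case r of None \<Rightarrow> None | Some z \<Rightarrow> run g (m # z # ys)) n)"
| "run (Mu f) xs =
     (if \<exists>n. run f (n # xs) = Some 0 \<and> (\<forall>m<n. run f (m # xs) \<noteq> None)
      then Some (LEAST n. run f (n # xs) = Some 0) else None)"

text \<open>Grammars are given to algorithms through an explicit injective coding.\<close>

fun code_symbol :: "symbol \<Rightarrow> nat" where
  "code_symbol (Tm b) = of_bool b"
| "code_symbol (Nt A) = A + 2"

fun code_prod :: "nat \<times> symbol list \<Rightarrow> nat" where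
  "code_prod (A, \<alpha>) = prod_encode (A, list_encode (map code_symbol \<alpha>))"

definition code_cfg :: "cfg \<Rightarrow> nat" where
  "code_cfg \<Gamma> = prod_encode (start \<Gamma>, list_encode (map code_prod (prods \<Gamma>)))"

lemma inj_code_symbol: "inj code_symbol"
proof (rule injI)
  fix x y :: symbol
  assume "code_symbol x = code_symbol y"
  then show "x = y"
    by (cases x; cases y) (auto simp: of_bool_def split: if_splits)
qed

lemma inj_code_prod: "inj code_prod"
proof (rule injI)
  fix p q :: "nat \<times> symbol list"
  assume "code_prod p = code_prod q"
  then show "p = q"
    by (cases p; cases q) (auto simp: list_encode_eq inj_map_eq_map[OF inj_code_symbol])
qed

lemma inj_code_cfg: "inj code_cfg"
proof (rule injI)
  fix \<Gamma> \<Delta> :: cfg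
  assume "code_cfg \<Gamma> = code_cfg \<Delta>"
  then show "\<Gamma> = \<Delta>"
    by (cases \<Gamma>; cases \<Delta>) (auto simp: code_cfg_def list_encode_eq inj_map_eq_map[OF inj_code_prod])
qed

text \<open>\<open>decides_given M P Q\<close>: on every input grammar satisfying the promise \<open>P\<close>, \<open>M\<close> halts
  and reports whether \<open>Q\<close> holds. Nothing is required of \<open>M\<close> on other inputs.\<close>

definition decides_given :: "recf \<Rightarrow> (cfg \<Rightarrow> bool) \<Rightarrow> (cfg \<Rightarrow> bool) \<Rightarrow> bool" where
  "decides_given M P Q \<longleftrightarrow>
     (\<forall>\<Gamma>. P \<Gamma> \<longrightarrow> run M [code_cfg \<Gamma>] = Some (if Q \<Gamma> then 1 else 0))"

end

theory Submission
  imports Defs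
begin

text \<open>If \<open>L\<close> contains a word \<open>x\<close> with both letters, replace every 0 in \<open>x\<close> by the word
  \<open>u\<^sub>1\<dots>u\<^sub>n\<close> and every 1 by \<open>v\<^sub>1\<dots>v\<^sub>n\<close>: each pair \<open>u\<^sub>i, v\<^sub>j\<close> projects to \<open>x\<close>, so the
  represented graph contains a complete bipartite graph with parts of size \<open>n\<close> and has large
  degeneracy and treewidth. Otherwise all represented graphs are edgeless. Hence both questions
  ask whether the grammar generates a word with both letters. This is decided by saturation: the
  finite set of letter sets derivable from suffixes of right-hand sides is the set with least code
  among those closed under finitely many rules with bounded quantifiers, so one unbounded
  minimization finds it.\<close>

section \<open>Treewidth and minimum degree\<close>

abbreviation adj_rel :: "'a graph \<Rightarrow> ('a \<times> 'a) set" where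
  "adj_rel G \<equiv> {(x, y). {x, y} \<in> edges G}"

lemma connected_subsingleton:
  assumes "verts G \<subseteq> {r}"
  shows "connected G"
  unfolding connected_def
proof (intro ballI)
  fix u v assume "u \<in> verts G" "v \<in> verts G"
  then have "u = r" "v = r" using assms by auto
  then show "(u, v) \<in> (adj_rel G)\<^sup>*" by (simp only: rtrancl.rtrancl_refl)
qed

lemma is_tree_singleton: "is_tree (Graph {r} {})"
proof -
  have "\<not> is_cycle (Graph {r} {}) c" for c
  proof
    assume "is_cycle (Graph {r} {}) c"
    then have len: "3 \<le> length c"
      and edge: "\<And>i. i < length c \<Longrightarrow> {c ! i, c ! (Suc i mod length c)} \<in> edges (Graph {r} {})"
      unfolding is_cycle_def by blast+
    have "0 < length c"
      using len by linarith
    from edge[OF this] show False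
      by simp
  qed
  moreover have "connected (Graph {r} {})"
    by (rule connected_subsingleton) simp
  moreover have "simple_graph (Graph {r} {})"
    by (simp add: simple_graph_def)
  ultimately show ?thesis
    unfolding is_tree_def by metis
qed

text \<open>\<open>treewidth\<close> is a \<open>LEAST\<close>, so it means something only once some
  decomposition exists: a single node whose bag is the whole vertex set.\<close>

lemma treewidth_attained:
  fixes G :: "'a graph"
  assumes "simple_graph G"
  obtains T :: "nat graph" and B where "tree_decomposition G T B" "width T B = treewidth G"
proof -
  have "e \<subseteq> verts G" if "e \<in> edges G" for e
    using assms that by (simp add: simple_graph_def)
  then have "tree_decomposition G (Graph {0::nat} {}) (\<lambda>_. verts G)"
    unfolding tree_decomposition_def
    by (simp add: is_tree_singleton connected_subsingleton[of _ 0] induced_def)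
  then have "\<exists>k. \<exists>(T :: nat graph) B. tree_decomposition G T B \<and> width T B = k"
    by blast
  from LeastI_ex[OF this] that show thesis
    unfolding treewidth_def by blast
qed

lemma treewidth_le:
  fixes T :: "nat graph"
  assumes "tree_decomposition G T B"
  shows "treewidth G \<le> width T B"
  unfolding treewidth_def using assms by (intro Least_le) blast

text \<open>Every edge contains the centre \<open>r\<close>, while on a cycle no single vertex meets
  all edges.\<close>

lemma is_tree_star:
  assumes "finite V" "r \<in> V"
  shows "is_tree (Graph V ((\<lambda>v. {r, v}) ` (V - {r})))" (is "is_tree ?T")
proof -
  have r_adj: "(r, v) \<in> (adj_rel ?T)\<^sup>*" "(v, r) \<in> (adj_rel ?T)\<^sup>*" if "v \<in> V" for v
  proof -
    have "v = r \<or> (r, v) \<in> adj_rel ?T \<and> (v, r) \<in> adj_rel ?T"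
      using that by (auto simp: insert_commute)
    then show "(r, v) \<in> (adj_rel ?T)\<^sup>*" "(v, r) \<in> (adj_rel ?T)\<^sup>*"
      by (elim disjE conjE; simp only: rtrancl.rtrancl_refl r_into_rtrancl)+
  qed
  have "connected ?T"
    unfolding connected_def graph.sel
    using rtrancl_trans[OF r_adj(2) r_adj(1)] by simp
  moreover have "\<not> is_cycle T c" if ends: "\<And>x y. {x, y} \<in> edges T \<Longrightarrow> x = r \<or> y = r"
    for T :: "'a graph" and c
  proof
    assume c: "is_cycle T c"
    then have len: "length c \<ge> 3" and d: "distinct c"
      and e: "\<And>i. i < length c \<Longrightarrow> {c ! i, c ! (Suc i mod length c)} \<in> edges T"
      by (simp_all add: is_cycle_def)
    have step: "c ! i = r \<or> c ! j = r" if "i < length c" "Suc i mod length c = j" for i j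
      using ends[OF e[OF that(1)]] that(2) by blast
    obtain n where n: "length c = Suc n" "n \<ge> 2"
      using len by (cases "length c") simp_all
    \<comment> \<open>Three edges of the cycle without a common vertex. For a triangle
      \<open>n\<close> is 2; in general \<open>n \<ge> 2\<close> keeps \<open>c ! 1\<close> apart
      from \<open>c ! n\<close>.\<close>
    have "c ! 0 = r \<or> c ! 1 = r" "c ! 1 = r \<or> c ! 2 = r" "c ! n = r \<or> c ! 0 = r"
      using step[of 0 1] step[of 1 2] step[of n 0] n by simp_all
    moreover have "c ! i \<noteq> c ! j" if "i < j" "j < length c" for i j
      using d that by (simp add: nth_eq_iff_index_eq)
    then have "c ! 0 \<noteq> c ! 1" "c ! 0 \<noteq> c ! 2" "c ! 1 \<noteq> c ! n"
      using len n by simp_all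
    ultimately show False
      by metis
  qed
  moreover have "x = r \<or> y = r" if "{x, y} \<in> edges ?T" for x y
  proof -
    from that obtain v where "{x, y} = {r, v}"
      unfolding graph.sel by (rule imageE)
    then show ?thesis unfolding doubleton_eq_iff by metis
  qed
  moreover have "simple_graph ?T"
    using assms by (auto simp: simple_graph_def card_insert_if)
  ultimately show ?thesis
    unfolding is_tree_def by metis
qed

text \<open>Singleton bags on a tree over the vertex set itself have width 0. Each vertex lies in
  one bag only, so the shape of the tree is irrelevant and a star is the simplest choice.\<close>

lemma treewidth_edgeless:
  fixes G :: "nat graph"
  assumes "simple_graph G" "edges G = {}"
  shows "treewidth G = 0"
proof -
  obtain r where r: "r \<in> verts G" and fin: "finite (verts G)"
    using assms(1) by (auto simp: simple_graph_def)
  define T where "T = Graph (verts G) ((\<lambda>v. {r, v}) ` (verts G - {r}))"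
  have "connected (induced T {t. v \<in> {t}})" for v
    by (rule connected_subsingleton[of _ v]) (auto simp: induced_def)
  moreover have "is_tree T"
    unfolding T_def by (rule is_tree_star[OF fin r])
  ultimately have "tree_decomposition G T (\<lambda>v. {v})"
    unfolding tree_decomposition_def using assms(2) by (simp add: T_def)
  moreover have "width T (\<lambda>v. {v}) = 0"
    using r by (auto simp: width_def T_def image_constant_conv)
  ultimately show ?thesis
    using treewidth_le[of G T "\<lambda>v. {v}"] by simp
qed

lemma simple_graph_edgeD:
  assumes "simple_graph G" "{x, y} \<in> edges G"
  shows "x \<in> verts G" "y \<in> verts G" "x \<noteq> y"
  using assms by (fastforce simp: simple_graph_def)+

text \<open>The first vertex of a longest path is a leaf: another neighbour off the path would
  extend the path, one on the path would close a cycle. Two distinct nodes provide a first edge,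
  hence a path to start from.\<close>

lemma tree_has_leaf:
  assumes T: "is_tree T" and ab: "a \<in> verts T" "b \<in> verts T" "a \<noteq> b"
  obtains t s where "{t, s} \<in> edges T" "\<And>y. {t, y} \<in> edges T \<Longrightarrow> y = s"
proof -
  define path where "path p \<longleftrightarrow> distinct p \<and> length p \<ge> 2 \<and>
    (\<forall>i. Suc i < length p \<longrightarrow> {p ! i, p ! Suc i} \<in> edges T)" for p
  have sg: "simple_graph T" and fin: "finite (verts T)"
    using T by (auto simp: is_tree_def simple_graph_def)
  have "(a, b) \<in> (adj_rel T)\<^sup>*"
    using T ab by (auto simp: is_tree_def connected_def)
  then obtain c where "{a, c} \<in> edges T"
    using \<open>a \<noteq> b\<close> by (auto elim: converse_rtranclE)
  then have ac: "path [a, c]"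
    using simple_graph_edgeD[OF sg, of a c] by (auto simp: path_def)
  have bound: "length p \<le> card (verts T)" if "path p" for p
  proof -
    have "p ! i \<in> verts T" if "i < length p" for i
    proof (cases "Suc i < length p")
      case True
      then show ?thesis
        using \<open>path p\<close> simple_graph_edgeD[OF sg] by (auto simp: path_def)
    next
      case False
      \<comment> \<open>The last vertex of the path is the second end of the last edge.\<close>
      then have "i = Suc (i - 1)" "Suc (i - 1) < length p"
        using that \<open>path p\<close> by (auto simp: path_def)
      then show ?thesis
        using \<open>path p\<close> simple_graph_edgeD(2)[OF sg] unfolding path_def by metis
    qed
    then have "set p \<subseteq> verts T"
      by (auto simp: in_set_conv_nth)
    then show ?thesis
      using \<open>path p\<close> fin by (metis path_def card_mono distinct_card)
  qed
  \<comment> \<open>Paths have distinct vertices, so the number of nodes bounds their length and a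
    longest one exists.\<close>
  obtain p where p: "path p" and max: "\<And>q. path q \<Longrightarrow> length q \<le> length p"
    using ex_has_greatest_nat[of path "[a, c]" length "Suc (card (verts T))"] ac bound
    by (metis less_Suc_eq_le)
  from p have len: "length p \<ge> 2" and d: "distinct p"
    and e: "\<And>i. Suc i < length p \<Longrightarrow> {p ! i, p ! Suc i} \<in> edges T"
    by (auto simp: path_def)
  have "y = p ! 1" if y: "{p ! 0, y} \<in> edges T" for y
  proof (rule ccontr)
    assume neq: "y \<noteq> p ! 1"
    have "y \<in> set p"
    proof (rule ccontr)
      assume "y \<notin> set p"
      then have "path (y # p)"
        using d e len y by (auto simp: path_def nth_Cons insert_commute split: nat.split)
      then show False
        using max[of "y # p"] by simp
    qed
    then obtain k where k: "k < length p" "y = p ! k"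
      by (auto simp: in_set_conv_nth)
    have "k \<noteq> 0"
      using simple_graph_edgeD(3)[OF sg y] k by metis
    then have k2: "k \<ge> 2"
      using neq k by (cases "k = 1") auto
    \<comment> \<open>The edge from \<open>p ! k\<close> back to \<open>p ! 0\<close> closes the
      initial segment; \<open>k \<ge> 2\<close> gives it at least three vertices.\<close>
    have "is_cycle T (take (Suc k) p)"
      unfolding is_cycle_def
    proof (intro conjI allI impI)
      fix i assume "i < length (take (Suc k) p)"
      then have i: "i \<le> k" using k by simp
      show "{take (Suc k) p ! i, take (Suc k) p ! (Suc i mod length (take (Suc k) p))} \<in> edges T"
      proof (cases "i = k")
        case True
        then show ?thesis
          using k y by (simp add: insert_commute min_absorb2)
      next
        case False
        then show ?thesis
          using i k e[of i] by (simp add: min_absorb2)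
      qed
    qed (use k k2 d in auto)
    then show False
      using T by (auto simp: is_tree_def)
  qed
  with that[of "p ! 0" "p ! 1"] e[of 0] len show thesis by auto
qed

text \<open>Retracting a leaf onto its neighbour maps walks to walks, so it keeps connectedness.\<close>

lemma connected_delete_leaf:
  assumes con: "connected (induced T S)"
    and leaf: "\<And>y. {t, y} \<in> edges T \<Longrightarrow> y = s"
    and s: "t \<in> S \<Longrightarrow> s \<in> S"
  shows "connected (induced T (S - {t}))"
proof -
  define f where "f x = (if x = t then s else x)" for x
  have hom: "(f u, f v) \<in> (adj_rel (induced T (S - {t})))\<^sup>*"
    if "(u, v) \<in> (adj_rel (induced T S))\<^sup>*" for u v
    using that
  proof (induction rule: rtrancl_induct)
    case (step y z)
    then have yz: "{y, z} \<in> edges T" "y \<in> S" "z \<in> S"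
      by (auto simp: induced_def)
    then have "f y = f z \<or> {f y, f z} \<in> edges (induced T (S - {t}))"
      using leaf[of y] leaf[of z]
      by (cases "y = t"; cases "z = t") (auto simp: f_def induced_def insert_commute)
    with step.IH show ?case
      by (auto intro: rtrancl_into_rtrancl)
  qed simp
  show ?thesis
    unfolding connected_def
  proof (intro ballI)
    fix u v assume uv: "u \<in> verts (induced T (S - {t}))" "v \<in> verts (induced T (S - {t}))"
    then have "(u, v) \<in> (adj_rel (induced T S))\<^sup>*"
      using con by (auto simp: connected_def induced_def)
    from hom[OF this] uv show "(u, v) \<in> (adj_rel (induced T (S - {t})))\<^sup>*"
      by (auto simp: f_def induced_def)
  qed
qed

lemma induced_induced: "induced (induced G S) S' = induced G (S \<inter> S')"
  by (auto simp: induced_def)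

lemma is_cycle_mono:
  assumes "is_cycle H c" "edges H \<subseteq> edges G"
  shows "is_cycle G c"
  using assms by (auto simp: is_cycle_def)

text \<open>Induction on the number of tree nodes. A leaf whose bag lies inside its neighbour's bag
  can be deleted. Otherwise the leaf's bag has a vertex that no other bag contains, and then all
  edges at this vertex must be covered there.\<close>

lemma bag_contains_closed_neighbourhood:
  assumes "simple_graph G" "tree_decomposition G T B"
  shows "\<exists>v\<in>verts G. \<exists>t\<in>verts T. insert v {u. {u, v} \<in> edges G} \<subseteq> B t"
  using assms(2)
proof (induction "card (verts T)" arbitrary: T rule: less_induct)
  case less
  have tree: "is_tree T" and cover: "(\<Union>t\<in>verts T. B t) = verts G"
    and edge: "\<And>e. e \<in> edges G \<Longrightarrow> \<exists>t\<in>verts T. e \<subseteq> B t"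
    and con: "\<And>v. v \<in> verts G \<Longrightarrow> connected (induced T {t. v \<in> B t})"
    using less.prems by (auto simp: tree_decomposition_def)
  have sgT: "simple_graph T" and fin: "finite (verts T)"
    using tree by (auto simp: is_tree_def simple_graph_def)
  show ?case
  proof (cases "\<exists>a b. a \<in> verts T \<and> b \<in> verts T \<and> a \<noteq> b")
    case False
    obtain v where v: "v \<in> verts G"
      using assms(1) by (auto simp: simple_graph_def)
    with cover obtain t where t: "t \<in> verts T" "v \<in> B t" by blast
    with False have "verts T = {t}" by blast
    then have "B t = verts G" using cover by simp
    then show ?thesis
      using v t simple_graph_edgeD[OF assms(1)] by (intro bexI[of _ v] bexI[of _ t]) auto
  next
    case True
    then obtain t s where ts: "{t, s} \<in> edges T" and leaf: "\<And>y. {t, y} \<in> edges T \<Longrightarrow> y = s"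
      using tree_has_leaf[OF tree] by metis
    have tsv: "t \<in> verts T" "s \<in> verts T" "t \<noteq> s"
      using simple_graph_edgeD[OF sgT ts] by auto
    show ?thesis
    proof (cases "B t \<subseteq> B s")
      case True
      define T' where "T' = induced T (- {t})"
      have T'v: "verts T' = verts T - {t}"
        by (auto simp: T'_def induced_def)
      \<comment> \<open>Lets the leaf lemma for induced subtrees speak about the whole tree.\<close>
      have "induced T UNIV = T"
        by (cases T) (simp add: induced_def)
      then have "connected T'"
        using connected_delete_leaf[of T UNIV t s] leaf tree
        by (auto simp: is_tree_def T'_def Compl_eq_Diff_UNIV)
      moreover have "simple_graph T'"
        using sgT tsv by (auto simp: simple_graph_def T'_def induced_def)
      moreover have "\<not> is_cycle T' c" for c
        using tree is_cycle_mono[of T' c T] by (auto simp: is_tree_def T'_def induced_def)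
      ultimately have "is_tree T'"
        by (auto simp: is_tree_def)
      moreover have "(\<Union>t\<in>verts T'. B t) = verts G"
        using cover True tsv unfolding T'v by blast
      moreover have "\<exists>t\<in>verts T'. e \<subseteq> B t" if "e \<in> edges G" for e
        using edge[OF that] True tsv unfolding T'v by blast
      moreover have "connected (induced T' {t. v \<in> B t})" if "v \<in> verts G" for v
      proof -
        \<comment> \<open>The last \<open>t\<close> is the leaf, the bound one is any node. Since
          \<open>B t \<subseteq> B s\<close>, the leaf's neighbour \<open>s\<close> belongs to the
          subtree of \<open>v\<close> whenever the leaf does.\<close>
        have "connected (induced T ({t. v \<in> B t} - {t}))"
          using connected_delete_leaf[OF con[OF that], of t s] leaf True by auto
        moreover have "{t. v \<in> B t} - {t} = - {t} \<inter> {t. v \<in> B t}"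
          by auto
        ultimately show ?thesis
          by (simp add: T'_def induced_induced)
      qed
      ultimately have "tree_decomposition G T' B"
        by (auto simp: tree_decomposition_def)
      moreover have "card (verts T') < card (verts T)"
        unfolding T'v using fin tsv by (metis card_Diff1_less)
      ultimately show ?thesis
        using less.hyps[of T'] T'v by blast
    next
      case False
      then obtain v where v: "v \<in> B t" "v \<notin> B s" by blast
      then have vG: "v \<in> verts G" using cover tsv by blast
      have only: "t' = t" if "t' \<in> verts T" "v \<in> B t'" for t'
      proof (rule ccontr)
        assume "t' \<noteq> t"
        \<comment> \<open>A walk inside the subtree of \<open>v\<close> that leaves the leaf must
          first step to \<open>s\<close>, but \<open>v\<close> is not in \<open>B s\<close>.\<close>
        have "(t, t') \<in> (adj_rel (induced T {t. v \<in> B t}))\<^sup>*"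
          using con[OF vG] that tsv v by (auto simp: connected_def induced_def)
        then obtain y where "{t, y} \<in> edges (induced T {t. v \<in> B t})"
          using \<open>t' \<noteq> t\<close> by (auto elim: converse_rtranclE)
        then show False
          using leaf[of y] v by (auto simp: induced_def)
      qed
      have "u \<in> B t" if "{u, v} \<in> edges G" for u
        using edge[OF that] only by auto
      then show ?thesis
        using vG tsv v by blast
    qed
  qed
qed

lemma min_degree_le_treewidth:
  assumes G: "simple_graph G" and d: "\<And>v. v \<in> verts G \<Longrightarrow> d \<le> degree G v"
  shows "d \<le> treewidth G"
proof -
  obtain T :: "nat graph" and B where TB: "tree_decomposition G T B" "width T B = treewidth G"
    using treewidth_attained[OF G] .
  obtain v t where v: "v \<in> verts G" and t: "t \<in> verts T"
    and sub: "insert v {u. {u, v} \<in> edges G} \<subseteq> B t"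
    using bag_contains_closed_neighbourhood[OF G TB(1)] by blast
  have fin: "finite (verts G)" "finite (verts T)" and Bt: "B t \<subseteq> verts G"
    using G TB(1) t by (auto simp: tree_decomposition_def is_tree_def simple_graph_def)
  have "{v, v} \<notin> edges G"
    using simple_graph_edgeD(3)[OF G] by blast
  \<comment> \<open>The vertex \<open>v\<close> itself adds one to its degree, which makes up for
    the subtraction in \<open>width\<close>.\<close>
  then have "Suc (degree G v) = card (insert v {u \<in> verts G. {u, v} \<in> edges G})"
    using fin by (simp add: degree_def)
  also have "\<dots> \<le> card (B t)"
    using sub finite_subset[OF Bt fin(1)] by (intro card_mono) auto
  also have "\<dots> \<le> Max ((\<lambda>t. card (B t)) ` verts T)"
    using t fin by (intro Max_ge) auto
  finally show ?thesis
    using d[OF v] TB(2) by (simp add: width_def)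
qed

section \<open>Blow-ups of words\<close>

lemma simple_graph_word_graph: "w \<noteq> [] \<Longrightarrow> simple_graph (word_graph L w)"
  by (auto simp: simple_graph_def word_graph_def)

lemma graph_iso_refl: "graph_iso G G"
  unfolding graph_iso_def by (intro exI[of _ id]) auto

lemma word_graph_in_graph_class: "w \<noteq> [] \<Longrightarrow> word_graph L w \<in> graph_class L"
  using simple_graph_word_graph graph_iso_refl
  by (auto simp: graph_class_def representable_def)

lemma set_hproj: "u \<in> set w \<Longrightarrow> v \<in> set w \<Longrightarrow> u \<noteq> v \<Longrightarrow> set (hproj u v w) = {False, True}"
  by (auto simp: hproj_def split: if_splits)

text \<open>Every vertex occurs in the word, so each projection contains both letters
  (\<open>set_hproj\<close>); only mixed words of \<open>L\<close> can create edges.\<close>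

lemma edgeless_of_no_mixed_word:
  assumes L: "\<And>x. x \<in> L \<Longrightarrow> set x \<noteq> {False, True}" and G: "G \<in> graph_class L"
  shows "edges G = {}"
proof -
  obtain w :: "nat list" where "graph_iso G (word_graph L w)"
    using G by (auto simp: graph_class_def representable_def)
  moreover have "edges (word_graph L w) = {}"
    using L set_hproj by (fastforce simp: word_graph_def)
  ultimately show ?thesis
    by (auto simp: graph_iso_def)
qed

text \<open>No block repeats a letter, so keeping one letter from each side leaves exactly one
  letter per block, in the pattern of \<open>x\<close>.\<close>

definition blow_up :: "nat \<Rightarrow> bool list \<Rightarrow> nat list" where
  "blow_up n x = concat (map (\<lambda>b. if b then [n..<2*n] else [0..<n]) x)"

lemma hproj_append: "hproj u v (w @ w') = hproj u v w @ hproj u v w'"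
  by (simp add: hproj_def)

lemma hproj_Cons:
  "hproj u v (x # w) = (if x = u then [False] else if x = v then [True] else []) @ hproj u v w"
  by (simp add: hproj_def)

lemma hproj_eq_Nil: "u \<notin> set w \<Longrightarrow> v \<notin> set w \<Longrightarrow> hproj u v w = []"
  by (induction w) (simp add: hproj_def, auto simp: hproj_Cons)

lemma hproj_distinct_left:
  "distinct w \<Longrightarrow> u \<in> set w \<Longrightarrow> v \<notin> set w \<Longrightarrow> hproj u v w = [False]"
  by (induction w) (auto simp: hproj_Cons hproj_eq_Nil)

lemma hproj_distinct_right:
  "distinct w \<Longrightarrow> u \<notin> set w \<Longrightarrow> v \<in> set w \<Longrightarrow> hproj u v w = [True]"
  by (induction w) (auto simp: hproj_Cons hproj_eq_Nil)

lemma hproj_blow_up: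
  assumes "u < n" "n \<le> v" "v < 2 * n"
  shows "hproj u v (blow_up n x) = x"
proof (induction x)
  case Nil
  show ?case by (simp add: blow_up_def hproj_def)
next
  case (Cons b x)
  have "blow_up n (b # x) = (if b then [n..<2*n] else [0..<n]) @ blow_up n x"
    by (simp add: blow_up_def)
  moreover have "hproj u v (if b then [n..<2*n] else [0..<n]) = [b]"
    using assms by (simp add: hproj_distinct_left hproj_distinct_right)
  ultimately show ?case
    using Cons by (simp add: hproj_append)
qed

lemma set_blow_up:
  assumes "set x = {False, True}"
  shows "set (blow_up n x) = {..<2 * n}"
proof -
  have "set (blow_up n x) = (\<Union>b\<in>set x. set (if b then [n..<2 * n] else [0..<n]))"
    by (simp only: blow_up_def set_concat set_map image_image)
  also have "\<dots> = {0..<n} \<union> {n..<2 * n}"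
    unfolding assms by simp
  also have "\<dots> = {..<2 * n}"
    by auto
  finally show ?thesis .
qed

text \<open>Each vertex is adjacent to the entire opposite side. Vertices of the same side may be
  adjacent as well, which only raises degrees. Sides of size \<open>Suc n\<close> beat a proposed
  bound \<open>n\<close>.\<close>

lemma blow_up_graph:
  assumes x: "x \<in> L" "set x = {False, True}"
    and G_def: "G = word_graph L (blow_up (Suc n) x)"
  shows "G \<in> graph_class L" "\<And>v. v \<in> verts G \<Longrightarrow> Suc n \<le> degree G v"
proof -
  have set: "set (blow_up (Suc n) x) = {..<2 * Suc n}"
    using x(2) by (rule set_blow_up)
  have "0 \<in> set (blow_up (Suc n) x)"
    by (simp add: set)
  then have "blow_up (Suc n) x \<noteq> []"
    by (metis empty_iff list.set(1))
  then show "G \<in> graph_class L"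
    by (simp add: G_def word_graph_in_graph_class)
  \<comment> \<open>Edges are unordered, so the orientation that reads the lower letter as 0 gives
    the edge.\<close>
  have edge: "{u, v} \<in> edges G" if "u < Suc n" "Suc n \<le> v" "v < 2 * Suc n" for u v
  proof -
    have "hproj u v (blow_up (Suc n) x) \<in> L"
      using hproj_blow_up[OF that] x(1) by simp
    moreover have "u \<noteq> v" "u \<in> set (blow_up (Suc n) x)" "v \<in> set (blow_up (Suc n) x)"
      using that by (simp_all add: set)
    ultimately show ?thesis
      unfolding G_def word_graph_def graph.sel by blast
  qed
  fix v assume "v \<in> verts G"
  then have v: "v < 2 * Suc n"
    using set by (simp add: G_def word_graph_def)
  have V: "verts G = {..<2 * Suc n}"
    using set by (simp add: G_def word_graph_def)
  \<comment> \<open>The side opposite to \<open>v\<close>.\<close>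
  define N where "N = (if v < Suc n then {Suc n..<2 * Suc n} else {..<Suc n})"
  have "{u, v} \<in> edges G" if "u \<in> N" for u
    using edge[of u v] edge[of v u] v that
    by (cases "v < Suc n") (simp_all add: N_def insert_commute[of u v])
  moreover have "N \<subseteq> verts G"
    unfolding N_def V by auto
  ultimately have "N \<subseteq> {u \<in> verts G. {u, v} \<in> edges G}"
    by blast
  moreover have "card N = Suc n"
    by (simp add: N_def)
  moreover have "finite {u \<in> verts G. {u, v} \<in> edges G}"
    by (simp add: V)
  ultimately show "Suc n \<le> degree G v"
    unfolding degree_def by (metis card_mono)
qed

text \<open>A mixed word yields graphs of arbitrarily large minimum degree, hence of large
  treewidth; without one, all graphs are edgeless and 0 is a bound.\<close>

lemma bounded_treewidth_iff:
  "bounded_treewidth (graph_class L) \<longleftrightarrow> (\<forall>x\<in>L. set x \<noteq> {False, True})"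
proof
  assume "bounded_treewidth (graph_class L)"
  then obtain k where k: "\<And>G. G \<in> graph_class L \<Longrightarrow> treewidth G \<le> k"
    by (auto simp: bounded_treewidth_def)
  show "\<forall>x\<in>L. set x \<noteq> {False, True}"
  proof (intro ballI notI)
    fix x assume x: "x \<in> L" "set x = {False, True}"
    note G = blow_up_graph[OF x refl, where n = k]
    have "Suc k \<le> treewidth (word_graph L (blow_up (Suc k) x))"
      using G by (intro min_degree_le_treewidth) (auto simp: graph_class_def)
    with k[OF G(1)] show False by simp
  qed
next
  assume "\<forall>x\<in>L. set x \<noteq> {False, True}"
  then show "bounded_treewidth (graph_class L)"
    unfolding bounded_treewidth_def
  proof (intro exI[of _ 0] ballI)
    fix G assume L: "\<forall>x\<in>L. set x \<noteq> {False, True}" and G: "G \<in> graph_class L"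
    have "edges G = {}"
      using L by (intro edgeless_of_no_mixed_word[OF _ G]) blast
    with G show "treewidth G \<le> 0"
      by (simp add: treewidth_edgeless graph_class_def)
  qed
qed

lemma subgraph_refl: "simple_graph G \<Longrightarrow> subgraph G G"
  by (simp add: subgraph_def)

lemma bounded_degeneracy_iff:
  "bounded_degeneracy (graph_class L) \<longleftrightarrow> (\<forall>x\<in>L. set x \<noteq> {False, True})"
proof
  assume "bounded_degeneracy (graph_class L)"
  then obtain d where d: "\<And>G. G \<in> graph_class L \<Longrightarrow> degenerate d G"
    by (auto simp: bounded_degeneracy_def)
  show "\<forall>x\<in>L. set x \<noteq> {False, True}"
  proof (intro ballI notI)
    fix x assume x: "x \<in> L" "set x = {False, True}"
    note G = blow_up_graph[OF x refl, where n = d]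
    \<comment> \<open>The graph is its own subgraph of minimum degree above
      \<open>d\<close>.\<close>
    have "subgraph (word_graph L (blow_up (Suc d) x)) (word_graph L (blow_up (Suc d) x))"
      using G(1) by (simp add: graph_class_def subgraph_refl)
    then obtain v where "v \<in> verts (word_graph L (blow_up (Suc d) x))"
      "degree (word_graph L (blow_up (Suc d) x)) v \<le> d"
      using d[OF G(1)] unfolding degenerate_def by blast
    with G(2)[of v] show False by simp
  qed
next
  assume L: "\<forall>x\<in>L. set x \<noteq> {False, True}"
  have "degenerate 0 G" if "G \<in> graph_class L" for G
  proof -
    have "edges G = {}"
      using L by (intro edgeless_of_no_mixed_word[OF _ that]) blast
    show ?thesis
      unfolding degenerate_def
    proof (intro allI impI)
      fix H assume "subgraph H G"
      with \<open>edges G = {}\<close> have "edges H = {}" "verts H \<noteq> {}"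
        by (simp_all add: subgraph_def simple_graph_def)
      then show "\<exists>v\<in>verts H. degree H v \<le> 0"
        by (auto simp: degree_def)
    qed
  qed
  then show "bounded_degeneracy (graph_class L)"
    by (auto simp: bounded_degeneracy_def)
qed

section \<open>Closure properties of recursive functions\<close>

text \<open>Programs must halt on all tuples of length \<open>k\<close>; what \<open>f\<close> does
  on other lists is ignored, as \<open>computable_cong\<close> exploits.\<close>

definition computable :: "nat \<Rightarrow> (nat list \<Rightarrow> nat) \<Rightarrow> bool" where
  "computable k f \<longleftrightarrow> (\<exists>r. \<forall>xs. length xs = k \<longrightarrow> run r xs = Some (f xs))"

lemma computable_cong:
  "computable k f \<Longrightarrow> (\<And>xs. length xs = k \<Longrightarrow> f xs = g xs) \<Longrightarrow> computable k g"
  unfolding computable_def by metis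

lemma computable_comp:
  assumes h: "computable (length fs) h" and fs: "\<And>f. f \<in> set fs \<Longrightarrow> computable k f"
  shows "computable k (\<lambda>xs. h (map (\<lambda>f. f xs) fs))"
proof -
  obtain r where r: "\<And>ys. length ys = length fs \<Longrightarrow> run r ys = Some (h ys)"
    using h by (auto simp: computable_def)
  obtain R where R: "\<And>f xs. f \<in> set fs \<Longrightarrow> length xs = k \<Longrightarrow> run (R f) xs = Some (f xs)"
    using fs unfolding computable_def by metis
  have "run (Comp r (map R fs)) xs = Some (h (map (\<lambda>f. f xs) fs))" if "length xs = k" for xs
  proof -
    have "map (\<lambda>g. run g xs) (map R fs) = map Some (map (\<lambda>f. f xs) fs)"
      using R that by simp
    then show ?thesis
      using r[of "map (\<lambda>f. f xs) fs"]
      by (auto simp only: run.simps Let_def map_map option.sel comp_def length_map in_set_conv_nth nth_map)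
        (auto simp: comp_def)
  qed
  then show ?thesis
    unfolding computable_def by blast
qed

text \<open>With the premise instantiated by a base function on raw arguments, this rule and its
  binary analogue become closure rules for that function; the \<open>lemmas\<close> below are
  obtained so.\<close>

lemma computable_comp1:
  "computable 1 (\<lambda>ys. h (ys ! 0)) \<Longrightarrow> computable k f \<Longrightarrow> computable k (\<lambda>xs. h (f xs))"
  using computable_comp[of "[f]" "\<lambda>ys. h (ys ! 0)" k] by simp

lemma computable_comp2:
  "computable 2 (\<lambda>ys. h (ys ! 0) (ys ! 1)) \<Longrightarrow> computable k f \<Longrightarrow> computable k g \<Longrightarrow>
    computable k (\<lambda>xs. h (f xs) (g xs))"
  using computable_comp[of "[f, g]" "\<lambda>ys. h (ys ! 0) (ys ! 1)" k] by (auto simp: numeral_2_eq_2)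

lemma computable_nth: "i < k \<Longrightarrow> computable k (\<lambda>xs. xs ! i)"
  unfolding computable_def by (intro exI[of _ "Proj i"]) auto

lemma computable_Suc_fun: "computable 1 (\<lambda>xs. Suc (xs ! 0))"
  unfolding computable_def by (intro exI[of _ Succ]) (auto simp: length_Suc_conv)

lemmas computable_Suc = computable_comp1[OF computable_Suc_fun]

lemma computable_const: "computable k (\<lambda>_. n)"
proof (induction n)
  case 0
  show ?case unfolding computable_def by (intro exI[of _ Zero]) auto
qed (rule computable_Suc)

text \<open>\<open>Prim\<close> recurses on its first argument and passes the others along.
  Composition with \<open>n\<close> and the projections allows any computable recursion
  depth.\<close>

lemma computable_rec:
  assumes a: "computable k a" and g: "computable (Suc (Suc k)) g" and n: "computable k n"
  shows "computable k (\<lambda>xs. rec_nat (a xs) (\<lambda>m z. g (m # z # xs)) (n xs))"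
proof -
  obtain ra rg where ra: "\<And>xs. length xs = k \<Longrightarrow> run ra xs = Some (a xs)"
    and rg: "\<And>xs. length xs = Suc (Suc k) \<Longrightarrow> run rg xs = Some (g xs)"
    using a g by (auto simp: computable_def)
  define h where "h ys = rec_nat (a (tl ys)) (\<lambda>m z. g (m # z # tl ys)) (hd ys)" for ys
  have "run (Prim ra rg) ys = Some (h ys)" if len: "length ys = Suc k" for ys
  proof -
    obtain m xs where ys: "ys = m # xs" "length xs = k"
      using len by (cases ys) auto
    have "rec_nat (run ra xs) (\<lambda>m r. case r of None \<Rightarrow> None | Some z \<Rightarrow> run rg (m # z # xs)) m
      = Some (rec_nat (a xs) (\<lambda>m z. g (m # z # xs)) m)"
      by (induction m) (auto simp: ra rg ys)
    then show ?thesis by (simp add: ys h_def)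
  qed
  then have h: "computable (Suc k) h"
    unfolding computable_def by blast
  have "computable k (\<lambda>xs. h (map (\<lambda>f. f xs) (n # map (\<lambda>i xs. xs ! i) [0..<k])))"
    by (intro computable_comp) (auto simp: h n computable_nth)
  then show ?thesis
    by (rule computable_cong) (simp add: h_def comp_def, metis map_nth)
qed

lemma computable_Mu:
  assumes f: "computable (Suc k) f" and ex: "\<And>xs. length xs = k \<Longrightarrow> \<exists>n. f (n # xs) = 0"
  shows "computable k (\<lambda>xs. LEAST n. f (n # xs) = 0)"
proof -
  obtain r where r: "\<And>xs. length xs = Suc k \<Longrightarrow> run r xs = Some (f xs)"
    using f by (auto simp: computable_def)
  show ?thesis
    unfolding computable_def using r ex by (intro exI[of _ "Mu r"]) auto
qed

section \<open>Arithmetic by primitive recursion\<close>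

lemma computable_add_fun: "computable 2 (\<lambda>xs. xs ! 0 + xs ! 1)"
proof -
  \<comment> \<open>In the step functions here and below, \<open>ys ! 0\<close> is the counter and
    \<open>ys ! 1\<close> the value so far.\<close>
  have "computable 2 (\<lambda>xs. rec_nat (xs ! 1) (\<lambda>m z. (\<lambda>ys. Suc (ys ! 1)) (m # z # xs)) (xs ! 0))"
    by (intro computable_rec computable_Suc computable_nth) auto
  moreover have "rec_nat b (\<lambda>m z. Suc z) a = a + b" for a b :: nat
    by (induction a) auto
  ultimately show ?thesis by simp
qed

lemmas computable_add = computable_comp2[where h = "(+)", OF computable_add_fun]

lemma computable_pred_fun: "computable 1 (\<lambda>xs. xs ! 0 - 1)"
proof -
  have "computable 1 (\<lambda>xs. rec_nat 0 (\<lambda>m z. (\<lambda>ys. ys ! 0) (m # z # xs)) (xs ! 0))"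
    by (intro computable_rec computable_const computable_nth) auto
  moreover have "rec_nat 0 (\<lambda>m z. m) a = a - 1" for a :: nat
    by (cases a) auto
  ultimately show ?thesis by simp
qed

lemmas computable_pred = computable_comp1[where h = "\<lambda>n. n - 1", OF computable_pred_fun]

lemma computable_diff_fun: "computable 2 (\<lambda>xs. xs ! 0 - xs ! 1)"
proof -
  have "computable 2 (\<lambda>xs. rec_nat (xs ! 0) (\<lambda>m z. (\<lambda>ys. ys ! 1 - 1) (m # z # xs)) (xs ! 1))"
    by (intro computable_rec computable_pred computable_nth) auto
  moreover have "rec_nat a (\<lambda>m z. z - 1) b = a - b" for a b :: nat
    by (induction b) auto
  ultimately show ?thesis by simp
qed

lemmas computable_diff = computable_comp2[where h = "(-)", OF computable_diff_fun]

lemma computable_triangle_fun: "computable 1 (\<lambda>xs. triangle (xs ! 0))"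
proof -
  have "computable 1 (\<lambda>xs. rec_nat 0 (\<lambda>m z. (\<lambda>ys. ys ! 1 + Suc (ys ! 0)) (m # z # xs)) (xs ! 0))"
    by (intro computable_rec computable_add computable_Suc computable_const computable_nth) auto
  moreover have "rec_nat 0 (\<lambda>m z. z + Suc m) a = triangle a" for a :: nat
    by (induction a) auto
  ultimately show ?thesis by simp
qed

lemmas computable_triangle = computable_comp1[where h = triangle, OF computable_triangle_fun]

lemma computable_prod_encode:
  "computable k f \<Longrightarrow> computable k g \<Longrightarrow> computable k (\<lambda>xs. prod_encode (f xs, g xs))"
  unfolding prod_encode_def prod.case
  by (intro computable_add computable_triangle)

lemma computable_parity_fun: "computable 1 (\<lambda>xs. xs ! 0 mod 2)"
proof -
  have "computable 1 (\<lambda>xs. rec_nat 0 (\<lambda>m z. (\<lambda>ys. 1 - ys ! 1) (m # z # xs)) (xs ! 0))"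
    by (intro computable_rec computable_diff computable_const computable_nth) auto
  moreover have "rec_nat 0 (\<lambda>m z. 1 - z) a = a mod 2" for a :: nat
    by (induction a) (auto simp: mod_Suc)
  ultimately show ?thesis by simp
qed

lemmas computable_parity = computable_comp1[where h = "\<lambda>n. n mod 2", OF computable_parity_fun]

lemma computable_half_fun: "computable 1 (\<lambda>xs. xs ! 0 div 2)"
proof -
  \<comment> \<open>Half of \<open>Suc m\<close> exceeds half of \<open>m\<close> by one exactly
    when \<open>m\<close> is odd.\<close>
  have "computable 1 (\<lambda>xs. rec_nat 0 (\<lambda>m z. (\<lambda>ys. ys ! 1 + ys ! 0 mod 2) (m # z # xs)) (xs ! 0))"
    by (intro computable_rec computable_add computable_parity computable_const computable_nth) auto
  moreover have "rec_nat 0 (\<lambda>m z. z + m mod 2) a = a div 2" for a :: nat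
    by (induction a) (auto, presburger)
  ultimately show ?thesis by simp
qed

lemmas computable_half = computable_comp1[where h = "\<lambda>n. n div 2", OF computable_half_fun]

text \<open>The parity of this quotient is a binary digit, which decides membership in a set given
  by \<open>set_decode\<close>.\<close>

lemma computable_shift_fun: "computable 2 (\<lambda>xs. xs ! 1 div 2 ^ xs ! 0)"
proof -
  have "computable 2 (\<lambda>xs. rec_nat (xs ! 1) (\<lambda>m z. (\<lambda>ys. ys ! 1 div 2) (m # z # xs)) (xs ! 0))"
    by (intro computable_rec computable_half computable_nth) auto
  moreover have "rec_nat s (\<lambda>m z. z div 2) n = s div 2 ^ n" for s n :: nat
    by (induction n) (auto simp: div_mult2_eq[symmetric] mult.commute)
  ultimately show ?thesis by simp
qed

lemmas computable_shift = computable_comp2[where h = "\<lambda>n s. s div 2 ^ n", OF computable_shift_fun]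

text \<open>Truth is coded by 0, so that \<open>Mu\<close> searches for a witness and conjunction
  becomes addition.\<close>

definition decidable :: "nat \<Rightarrow> (nat list \<Rightarrow> bool) \<Rightarrow> bool" where
  "decidable k P \<longleftrightarrow> computable k (\<lambda>xs. of_bool (\<not> P xs))"

lemma decidableI:
  assumes "computable k f" "\<And>xs. length xs = k \<Longrightarrow> f xs = 0 \<longleftrightarrow> P xs"
  shows "decidable k P"
proof -
  \<comment> \<open>Truncated subtraction turns every nonzero value into 1.\<close>
  have "computable k (\<lambda>xs. 1 - (1 - f xs))"
    by (intro computable_diff computable_const assms)
  then show ?thesis
    unfolding decidable_def by (rule computable_cong) (auto simp flip: assms(2))
qed

lemma decidable_not: "decidable k P \<Longrightarrow> decidable k (\<lambda>xs. \<not> P xs)"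
  by (rule decidableI[of k "\<lambda>xs. 1 - of_bool (\<not> P xs)"])
    (auto simp: decidable_def intro!: computable_diff computable_const)

lemma decidable_conj: "decidable k P \<Longrightarrow> decidable k Q \<Longrightarrow> decidable k (\<lambda>xs. P xs \<and> Q xs)"
  by (rule decidableI[of k "\<lambda>xs. of_bool (\<not> P xs) + of_bool (\<not> Q xs)"])
    (auto simp: decidable_def intro!: computable_add)

lemma decidable_imp: "decidable k P \<Longrightarrow> decidable k Q \<Longrightarrow> decidable k (\<lambda>xs. P xs \<longrightarrow> Q xs)"
  using decidable_not[OF decidable_conj[of k P "\<lambda>xs. \<not> Q xs"]] decidable_not[of k Q] by simp

text \<open>With truncated subtraction, both differences vanish only for equal numbers.\<close>

lemma decidable_eq:
  "computable k f \<Longrightarrow> computable k g \<Longrightarrow> decidable k (\<lambda>xs. f xs = g xs)"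
  by (rule decidableI[of k "\<lambda>xs. (f xs - g xs) + (g xs - f xs)"])
    (auto intro!: computable_add computable_diff)

lemma decidable_le:
  "computable k f \<Longrightarrow> computable k g \<Longrightarrow> decidable k (\<lambda>xs. f xs \<le> g xs)"
  by (rule decidableI[of k "\<lambda>xs. f xs - g xs"]) (auto intro!: computable_diff)

lemma decidable_mem:
  assumes "computable k f" "computable k g"
  shows "decidable k (\<lambda>xs. f xs \<in> set_decode (g xs))"
proof (rule decidableI[of k "\<lambda>xs. 1 - g xs div 2 ^ f xs mod 2"])
  show "computable k (\<lambda>xs. 1 - g xs div 2 ^ f xs mod 2)"
    using assms by (intro computable_diff computable_const computable_parity computable_shift)
qed (auto simp: set_decode_def odd_iff_mod_2_eq_one)

text \<open>Recursion counts the counterexamples; the count is 0 iff there are none. Running it up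
  to \<open>Suc (n xs)\<close> includes the bound itself.\<close>

lemma decidable_all_le:
  assumes n: "computable k n" and P: "decidable (Suc k) P"
  shows "decidable k (\<lambda>xs. \<forall>i\<le>n xs. P (i # xs))"
proof -
  let ?g = "\<lambda>ys. ys ! 1 + of_bool (\<not> P (ys ! 0 # drop 2 ys))"
  \<comment> \<open>The step sees counter, count and parameters, whereas \<open>P\<close> wants
    counter and parameters only; the shifted projections skip the count.\<close>
  have "computable (Suc (Suc k)) (\<lambda>ys. (\<lambda>zs. of_bool (\<not> P zs))
     (map (\<lambda>f. f ys) ((\<lambda>ys. ys ! 0) # map (\<lambda>i ys. ys ! (i + 2)) [0..<k])))"
    using P unfolding decidable_def
    by (intro computable_comp) (auto intro!: computable_nth)
  then have "computable (Suc (Suc k)) (\<lambda>ys. of_bool (\<not> P (ys ! 0 # drop 2 ys)))"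
  proof (rule computable_cong)
    fix ys :: "nat list" assume "length ys = Suc (Suc k)"
    then have "map (\<lambda>f. f ys) (map (\<lambda>i ys. ys ! (i + 2)) [0..<k]) = drop 2 ys"
      by (intro nth_equalityI) (auto simp: add.commute)
    then show "of_bool (\<not> P (map (\<lambda>f. f ys) ((\<lambda>ys. ys ! 0) # map (\<lambda>i ys. ys ! (i + 2)) [0..<k])))
      = (of_bool (\<not> P (ys ! 0 # drop 2 ys)) :: nat)"
      by simp
  qed
  then have "computable k (\<lambda>xs. rec_nat 0 (\<lambda>m z. ?g (m # z # xs)) (Suc (n xs)))"
    by (intro computable_rec computable_const computable_add computable_nth computable_Suc n) auto
  then show ?thesis
  proof (rule decidableI)
    fix xs :: "nat list"
    have "rec_nat 0 (\<lambda>m z. ?g (m # z # xs)) m = 0 \<longleftrightarrow> (\<forall>i<m. P (i # xs))" for m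
      by (induction m) (auto simp: less_Suc_eq)
    from this[of "Suc (n xs)"]
    show "rec_nat 0 (\<lambda>m z. ?g (m # z # xs)) (Suc (n xs)) = 0 \<longleftrightarrow> (\<forall>i\<le>n xs. P (i # xs))"
      by (simp only: less_Suc_eq_le)
  qed
qed

text \<open>Arithmetical formulas with bounded quantifiers, in de Bruijn notation. The membership
  atom refers to the finite set with the given code.\<close>

datatype aterm = Var nat | Const nat | Succ_term aterm | Pair_term aterm aterm | Max_term aterm aterm

datatype aform = Eq aterm aterm | Le aterm aterm | Mem aterm aterm
  | Neg aform | Conj aform aform | Imp aform aform | All aterm aform

fun aval :: "nat list \<Rightarrow> aterm \<Rightarrow> nat" where
  "aval e (Var i) = e ! i"
| "aval e (Const n) = n"
| "aval e (Succ_term t) = Suc (aval e t)"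
| "aval e (Pair_term s t) = prod_encode (aval e s, aval e t)"
| "aval e (Max_term s t) = max (aval e s) (aval e t)"

fun holds :: "nat list \<Rightarrow> aform \<Rightarrow> bool" where
  "holds e (Eq s t) \<longleftrightarrow> aval e s = aval e t"
| "holds e (Le s t) \<longleftrightarrow> aval e s \<le> aval e t"
| "holds e (Mem s t) \<longleftrightarrow> aval e s \<in> set_decode (aval e t)"
| "holds e (Neg p) \<longleftrightarrow> \<not> holds e p"
| "holds e (Conj p q) \<longleftrightarrow> holds e p \<and> holds e q"
| "holds e (Imp p q) \<longleftrightarrow> (holds e p \<longrightarrow> holds e q)"
| "holds e (All t p) \<longleftrightarrow> (\<forall>i\<le>aval e t. holds (i # e) p)"

text \<open>Keeps every lookup \<open>e ! i\<close> inside an environment of length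
  \<open>k\<close>, where it is a projection.\<close>

fun term_vars_below :: "nat \<Rightarrow> aterm \<Rightarrow> bool" where
  "term_vars_below k (Var i) \<longleftrightarrow> i < k"
| "term_vars_below k (Const n) \<longleftrightarrow> True"
| "term_vars_below k (Succ_term t) \<longleftrightarrow> term_vars_below k t"
| "term_vars_below k (Pair_term s t) \<longleftrightarrow> term_vars_below k s \<and> term_vars_below k t"
| "term_vars_below k (Max_term s t) \<longleftrightarrow> term_vars_below k s \<and> term_vars_below k t"

fun vars_below :: "nat \<Rightarrow> aform \<Rightarrow> bool" where
  "vars_below k (Eq s t) \<longleftrightarrow> term_vars_below k s \<and> term_vars_below k t"
| "vars_below k (Le s t) \<longleftrightarrow> term_vars_below k s \<and> term_vars_below k t"
| "vars_below k (Mem s t) \<longleftrightarrow> term_vars_below k s \<and> term_vars_below k t"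
| "vars_below k (Neg p) \<longleftrightarrow> vars_below k p"
| "vars_below k (Conj p q) \<longleftrightarrow> vars_below k p \<and> vars_below k q"
| "vars_below k (Imp p q) \<longleftrightarrow> vars_below k p \<and> vars_below k q"
| "vars_below k (All t p) \<longleftrightarrow> term_vars_below k t \<and> vars_below (Suc k) p"

lemma computable_aval: "term_vars_below k t \<Longrightarrow> computable k (\<lambda>e. aval e t)"
proof (induction t)
  case (Max_term s t)
  \<comment> \<open>Under truncated subtraction this sum is the maximum.\<close>
  then have "computable k (\<lambda>e. aval e s + (aval e t - aval e s))"
    by (auto intro!: computable_add computable_diff)
  then show ?case
    by (rule computable_cong) auto
qed (auto intro!: computable_nth computable_const computable_Suc computable_prod_encode)

text \<open>Decidability of a concrete condition thereby reduces to writing it as a formula and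
  checking its variables.\<close>

lemma decidable_holds: "vars_below k p \<Longrightarrow> decidable k (\<lambda>e. holds e p)"
proof (induction p arbitrary: k)
  case (All t p)
  then show ?case
    using decidable_all_le[OF computable_aval, of k t "\<lambda>e. holds e p"] by simp
qed (auto intro!: decidable_eq decidable_le decidable_mem decidable_not decidable_conj
    decidable_imp computable_aval)

section \<open>Letters occurring in derived words\<close>

text \<open>Derivations organised along the symbol list, head first: inductions then peel off one
  symbol at a time, in step with \<open>list_encode\<close>.\<close>

inductive generates :: "cfg \<Rightarrow> symbol list \<Rightarrow> bool list \<Rightarrow> bool" for \<Gamma> where
  Nil: "generates \<Gamma> [] []"
| Tm: "generates \<Gamma> \<beta> w \<Longrightarrow> generates \<Gamma> (Tm b # \<beta>) (b # w)"
| Nt: "(A, \<alpha>) \<in> set (prods \<Gamma>) \<Longrightarrow> generates \<Gamma> \<alpha> v \<Longrightarrow> generates \<Gamma> \<beta> w \<Longrightarrow>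
    generates \<Gamma> (Nt A # \<beta>) (v @ w)"

lemma generates_append:
  "generates \<Gamma> \<beta> u \<Longrightarrow> generates \<Gamma> \<gamma> v \<Longrightarrow> generates \<Gamma> (\<beta> @ \<gamma>) (u @ v)"
  by (induction rule: generates.induct) (auto intro: generates.intros)

lemma generates_appendE:
  assumes "generates \<Gamma> (\<beta> @ \<gamma>) w"
  obtains u v where "w = u @ v" "generates \<Gamma> \<beta> u" "generates \<Gamma> \<gamma> v"
proof -
  have "\<exists>u v. w = u @ v \<and> generates \<Gamma> \<beta> u \<and> generates \<Gamma> \<gamma> v"
    using assms
  proof (induction \<beta> arbitrary: w)
    case Nil
    then show ?case by (auto intro: generates.Nil)
  next
    case (Cons x \<beta>)
    from Cons.prems[simplified] show ?case
    proof cases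
      case (Tm w' b)
      with Cons.IH[of w'] show ?thesis
        by (metis append_Cons generates.Tm)
    next
      case (Nt A \<alpha> v' w')
      with Cons.IH[of w'] show ?thesis
        by (metis append_assoc generates.Nt)
    qed
  qed
  with that show thesis by blast
qed

text \<open>One derivation step read backwards: the part of \<open>w\<close> generated by the
  inserted right-hand side is what the nonterminal generates.\<close>

lemma generates_derives1:
  assumes "derives1 \<Gamma> \<alpha> \<beta>" "generates \<Gamma> \<beta> w"
  shows "generates \<Gamma> \<alpha> w"
  using assms
proof cases
  case (1 A \<delta> \<beta>' \<gamma>)
  then obtain u v v' where "w = u @ v @ v'" "generates \<Gamma> \<beta>' u" "generates \<Gamma> \<delta> v" "generates \<Gamma> \<gamma> v'"
    using assms(2) by (metis generates_appendE)
  then show ?thesis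
    using 1 generates_append[OF _ generates.Nt] by simp
qed

lemma generates_map_Tm: "generates \<Gamma> (map Tm w) w"
  by (induction w) (auto intro: generates.intros)

lemma derives1_context: "derives1 \<Gamma> \<alpha> \<beta> \<Longrightarrow> derives1 \<Gamma> (\<gamma> @ \<alpha> @ \<delta>) (\<gamma> @ \<beta> @ \<delta>)"
proof (erule derives1.cases)
  fix A \<alpha>' \<beta>' \<gamma>'
  assume *: "\<alpha> = \<beta>' @ [Nt A] @ \<gamma>'" "\<beta> = \<beta>' @ \<alpha>' @ \<gamma>'" "(A, \<alpha>') \<in> set (prods \<Gamma>)"
  then show ?thesis
    using derives1.intros[OF *(3), of "\<gamma> @ \<beta>'" "\<gamma>' @ \<delta>"] by simp
qed

lemma derives_context:
  "(derives1 \<Gamma>)\<^sup>*\<^sup>* \<alpha> \<beta> \<Longrightarrow> (derives1 \<Gamma>)\<^sup>*\<^sup>* (\<gamma> @ \<alpha> @ \<delta>) (\<gamma> @ \<beta> @ \<delta>)"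
  by (induction rule: rtranclp_induct) (auto dest: derives1_context intro: rtranclp.rtrancl_into_rtrancl)

lemma generates_iff_derives: "generates \<Gamma> \<beta> w \<longleftrightarrow> (derives1 \<Gamma>)\<^sup>*\<^sup>* \<beta> (map Tm w)"
proof
  assume "generates \<Gamma> \<beta> w"
  then show "(derives1 \<Gamma>)\<^sup>*\<^sup>* \<beta> (map Tm w)"
  proof (induction rule: generates.induct)
    case (Tm \<beta> w b)
    then show ?case
      using derives_context[of \<Gamma> \<beta> "map Tm w" "[Tm b]" "[]"] by simp
  next
    case (Nt A \<alpha> v \<beta> w)
    have "derives1 \<Gamma> (Nt A # \<beta>) (\<alpha> @ \<beta>)"
      using derives1.intros[OF Nt.hyps(1), of "[]" \<beta>] by simp
    also have "(derives1 \<Gamma>)\<^sup>*\<^sup>* (\<alpha> @ \<beta>) (map Tm v @ \<beta>)"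
      using derives_context[OF Nt.IH(1), of "[]" \<beta>] by simp
    also have "(derives1 \<Gamma>)\<^sup>*\<^sup>* (map Tm v @ \<beta>) (map Tm v @ map Tm w)"
      using derives_context[OF Nt.IH(2), of "map Tm v" "[]"] by simp
    finally show ?case by simp
  qed simp
next
  assume "(derives1 \<Gamma>)\<^sup>*\<^sup>* \<beta> (map Tm w)"
  then show "generates \<Gamma> \<beta> w"
    by (induction rule: converse_rtranclp_induct) (auto intro: generates_map_Tm generates_derives1)
qed

text \<open>Passing to right-hand sides of the start symbol matters because their codes are bounded
  by the grammar's code, as the facts below demand.\<close>

lemma lang_iff_generates:
  "w \<in> lang \<Gamma> \<longleftrightarrow> (\<exists>\<alpha>. (start \<Gamma>, \<alpha>) \<in> set (prods \<Gamma>) \<and> generates \<Gamma> \<alpha> w)"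
proof -
  have "w \<in> lang \<Gamma> \<longleftrightarrow> generates \<Gamma> [Nt (start \<Gamma>)] w"
    by (simp add: lang_def generates_iff_derives)
  also have "\<dots> \<longleftrightarrow> (\<exists>\<alpha>. (start \<Gamma>, \<alpha>) \<in> set (prods \<Gamma>) \<and> generates \<Gamma> \<alpha> w)"
  proof
    assume "generates \<Gamma> [Nt (start \<Gamma>)] w"
    then show "\<exists>\<alpha>. (start \<Gamma>, \<alpha>) \<in> set (prods \<Gamma>) \<and> generates \<Gamma> \<alpha> w"
    proof cases
      case (Nt \<alpha> v w')
      moreover have "w' = []"
        using \<open>generates \<Gamma> [] w'\<close> by cases
      ultimately show ?thesis by auto
    qed
  qed (auto dest: generates.Nt[OF _ _ generates.Nil])
  finally show ?thesis .
qed

section \<open>Coded facts about letters of generated words\<close>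

definition code_fact :: "nat \<Rightarrow> nat \<Rightarrow> nat \<Rightarrow> nat" where
  "code_fact b i j = prod_encode (b, prod_encode (i, j))"

lemma code_fact_eq_iff [simp]: "code_fact b i j = code_fact b' i' j' \<longleftrightarrow> b = b' \<and> i = i' \<and> j = j'"
  by (auto simp: code_fact_def)

text \<open>For the code \<open>g\<close> of a grammar, \<open>code_fact b i j\<close> with \<open>i, j \<le> 1\<close> says that the symbol list
  coded by \<open>b\<close> generates a word in which 0 occurs iff \<open>i = 1\<close> and 1 occurs iff \<open>j = 1\<close>;
  \<open>code_fact c 2 0\<close> says that \<open>c\<close> codes a suffix of the list of productions. Only lists with code
  at most \<open>g\<close> are considered, which keeps the set finite.\<close>

inductive_set facts :: "nat \<Rightarrow> nat set" for g where
  prods: "g = prod_encode (s, l) \<Longrightarrow> code_fact l 2 0 \<in> facts g"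
| tl: "code_fact (Suc (prod_encode (p, c))) 2 0 \<in> facts g \<Longrightarrow> code_fact c 2 0 \<in> facts g"
| Nil: "code_fact 0 0 0 \<in> facts g"
| Zero: "code_fact c i j \<in> facts g \<Longrightarrow> i \<le> 1 \<Longrightarrow> j \<le> 1 \<Longrightarrow> Suc (prod_encode (0, c)) \<le> g \<Longrightarrow>
    code_fact (Suc (prod_encode (0, c))) 1 j \<in> facts g"
| One: "code_fact c i j \<in> facts g \<Longrightarrow> i \<le> 1 \<Longrightarrow> j \<le> 1 \<Longrightarrow> Suc (prod_encode (1, c)) \<le> g \<Longrightarrow>
    code_fact (Suc (prod_encode (1, c))) i 1 \<in> facts g"
| Nt: "code_fact c i j \<in> facts g \<Longrightarrow> code_fact a i' j' \<in> facts g \<Longrightarrow>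
    code_fact (Suc (prod_encode (prod_encode (n, a), d))) 2 0 \<in> facts g \<Longrightarrow>
    i \<le> 1 \<Longrightarrow> j \<le> 1 \<Longrightarrow> i' \<le> 1 \<Longrightarrow> j' \<le> 1 \<Longrightarrow> Suc (prod_encode (Suc (Suc n), c)) \<le> g \<Longrightarrow>
    code_fact (Suc (prod_encode (Suc (Suc n), c))) (max i i') (max j j') \<in> facts g"

lemma prod_encode_le1: "prod_encode (a, b) \<le> c \<Longrightarrow> a \<le> c"
  using le_prod_encode_1[of a b] by linarith

lemma prod_encode_le2: "prod_encode (a, b) \<le> c \<Longrightarrow> b \<le> c"
  using le_prod_encode_2[of b a] by linarith

text \<open>Makes the set of facts finite, hence codable by one number. Suffixes of the production
  list stay below \<open>g\<close> because a pair dominates its components.\<close>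

lemma facts_bounded: "x \<in> facts g \<Longrightarrow> \<exists>b\<le>g. \<exists>i\<le>2. \<exists>j\<le>1. x = code_fact b i j"
proof (induction rule: facts.induct)
  case (prods s l)
  then show ?case using le_prod_encode_2[of l s] by auto
next
  case (tl p c)
  then have "Suc (prod_encode (p, c)) \<le> g" by auto
  then show ?case using le_prod_encode_2[of c p] by auto
qed auto

lemma facts_boundedD: "code_fact b i j \<in> facts g \<Longrightarrow> b \<le> g"
  using facts_bounded[of "code_fact b i j" g] by auto

lemma finite_facts: "finite (facts g)"
proof (rule finite_subset)
  show "facts g \<subseteq> (\<lambda>(b, i, j). code_fact b i j) ` ({..g} \<times> {..2} \<times> {..1})"
  proof
    fix x assume "x \<in> facts g"
    from facts_bounded[OF this] obtain b i j where "b \<le> g" "i \<le> 2" "j \<le> 1" "x = code_fact b i j"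
      by blast
    then show "x \<in> (\<lambda>(b, i, j). code_fact b i j) ` ({..g} \<times> {..2} \<times> {..1})"
      by (intro image_eqI[of _ _ "(b, i, j)"]) auto
  qed
qed auto

text \<open>The rules of \<open>facts\<close> with every quantifier bounded, so that they form a
  decidable condition on \<open>g\<close> and a code of \<open>F\<close>.\<close>

definition closed_under_rules :: "nat \<Rightarrow> nat set \<Rightarrow> bool" where
  "closed_under_rules g F \<longleftrightarrow>
    (\<forall>s\<le>g. \<forall>l\<le>g. g = prod_encode (s, l) \<longrightarrow> code_fact l 2 0 \<in> F) \<and>
    (\<forall>p\<le>g. \<forall>c\<le>g. code_fact (Suc (prod_encode (p, c))) 2 0 \<in> F \<longrightarrow> code_fact c 2 0 \<in> F) \<and>
    code_fact 0 0 0 \<in> F \<and>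
    (\<forall>c\<le>g. \<forall>i\<le>1. \<forall>j\<le>1. code_fact c i j \<in> F \<and> Suc (prod_encode (0, c)) \<le> g \<longrightarrow>
      code_fact (Suc (prod_encode (0, c))) 1 j \<in> F) \<and>
    (\<forall>c\<le>g. \<forall>i\<le>1. \<forall>j\<le>1. code_fact c i j \<in> F \<and> Suc (prod_encode (1, c)) \<le> g \<longrightarrow>
      code_fact (Suc (prod_encode (1, c))) i 1 \<in> F) \<and>
    (\<forall>c\<le>g. \<forall>a\<le>g. \<forall>n\<le>g. \<forall>d\<le>g. \<forall>i\<le>1. \<forall>j\<le>1. \<forall>i'\<le>1. \<forall>j'\<le>1.
      code_fact c i j \<in> F \<and> code_fact a i' j' \<in> F \<and>
      code_fact (Suc (prod_encode (prod_encode (n, a), d))) 2 0 \<in> F \<and>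
      Suc (prod_encode (Suc (Suc n), c)) \<le> g \<longrightarrow>
      code_fact (Suc (prod_encode (Suc (Suc n), c))) (max i i') (max j j') \<in> F)"

lemma closed_under_rules_facts: "closed_under_rules g (facts g)"
  unfolding closed_under_rules_def using facts.intros by (intro conjI allI impI) metis+

text \<open>The bounds lose nothing: a list code in a fact is at most \<open>g\<close>, and pairing
  dominates its components, so all parameters of an applied rule lie within the bounds.\<close>

lemma facts_least:
  assumes "closed_under_rules g F"
  shows "facts g \<subseteq> F"
proof
  note rules = assms[unfolded closed_under_rules_def]
  note rule1 = rules[THEN conjunct1, rule_format]
    and rule2 = rules[THEN conjunct2, THEN conjunct1, rule_format]
    and rule3 = rules[THEN conjunct2, THEN conjunct2, THEN conjunct1]
    and rule4 = rules[THEN conjunct2, THEN conjunct2, THEN conjunct2, THEN conjunct1, rule_format]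
    and rule5 = rules[THEN conjunct2, THEN conjunct2, THEN conjunct2, THEN conjunct2,
        THEN conjunct1, rule_format]
    and rule6 = rules[THEN conjunct2, THEN conjunct2, THEN conjunct2, THEN conjunct2,
        THEN conjunct2, rule_format]
  fix x assume "x \<in> facts g"
  then show "x \<in> F"
  proof (induction rule: facts.induct)
    case (prods s l)
    show ?case
      by (rule rule1[of s l]) (use prods le_prod_encode_1 le_prod_encode_2 in auto)
  next
    case (tl p c)
    have "prod_encode (p, c) \<le> g"
      using facts_boundedD[OF tl.hyps] by simp
    note le = prod_encode_le1[OF this] prod_encode_le2[OF this]
    show ?case
      by (rule rule2[OF le tl.IH])
  next
    case Nil
    show ?case by (rule rule3)
  next
    case (Zero c i j)
    then show ?case
      by (intro rule4[OF facts_boundedD[OF Zero.hyps(1)]]) auto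
  next
    case (One c i j)
    then show ?case
      by (intro rule5[OF facts_boundedD[OF One.hyps(1)]]) auto
  next
    case (Nt c i j a i' j' n d)
    have "prod_encode (prod_encode (n, a), d) \<le> g"
      using facts_boundedD[OF Nt.hyps(3)] by simp
    note le = prod_encode_le1[OF this] prod_encode_le2[OF this]
    show ?case
      by (rule rule6[OF facts_boundedD[OF Nt.hyps(1)] prod_encode_le2[OF le(1)]
            prod_encode_le1[OF le(1)] le(2) Nt.hyps(4-7) conjI[OF Nt.IH(1) conjI[OF Nt.IH(2)
            conjI[OF Nt.IH(3) Nt.hyps(8)]]]])
  qed
qed

text \<open>The order of codes extends inclusion, so unbounded search for a closed set stops at the
  least one.\<close>

lemma least_closed_set:
  "(LEAST S. closed_under_rules g (set_decode S)) = set_encode (facts g)"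
proof (rule Least_equality)
  show "closed_under_rules g (set_decode (set_encode (facts g)))"
    by (simp add: finite_facts closed_under_rules_facts)
next
  fix S assume "closed_under_rules g (set_decode S)"
  then have "set_decode (set_encode (facts g)) \<subseteq> set_decode S"
    by (simp add: finite_facts facts_least)
  then show "set_encode (facts g) \<le> S"
    by (rule subset_decode_imp_le)
qed

section \<open>Formulas for closure and for the absence of mixed words\<close>

definition fact_term :: "aterm \<Rightarrow> aterm \<Rightarrow> aterm \<Rightarrow> aterm" where
  "fact_term b i j = Pair_term b (Pair_term i j)"

text \<open>Conjunct by conjunct \<open>closed_under_rules\<close>. The environment is
  \<open>[S, g]\<close>, the searched \<open>S\<close> in front as in \<open>Mu\<close>; under
  \<open>q\<close> quantifiers \<open>S\<close> is \<open>Var q\<close> and \<open>g\<close> is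
  \<open>Var (q + 1)\<close>.\<close>

definition closed_form :: aform where
  "closed_form =
    Conj (All (Var 1) (All (Var 2) (Imp (Eq (Var 3) (Pair_term (Var 1) (Var 0)))
      (Mem (fact_term (Var 0) (Const 2) (Const 0)) (Var 2)))))
    (Conj (All (Var 1) (All (Var 2)
      (Imp (Mem (fact_term (Succ_term (Pair_term (Var 1) (Var 0))) (Const 2) (Const 0)) (Var 2))
        (Mem (fact_term (Var 0) (Const 2) (Const 0)) (Var 2)))))
    (Conj (Mem (fact_term (Const 0) (Const 0) (Const 0)) (Var 0))
    (Conj (All (Var 1) (All (Const 1) (All (Const 1)
      (Imp (Conj (Mem (fact_term (Var 2) (Var 1) (Var 0)) (Var 3))
          (Le (Succ_term (Pair_term (Const 0) (Var 2))) (Var 4)))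
        (Mem (fact_term (Succ_term (Pair_term (Const 0) (Var 2))) (Const 1) (Var 0)) (Var 3))))))
    (Conj (All (Var 1) (All (Const 1) (All (Const 1)
      (Imp (Conj (Mem (fact_term (Var 2) (Var 1) (Var 0)) (Var 3))
          (Le (Succ_term (Pair_term (Const 1) (Var 2))) (Var 4)))
        (Mem (fact_term (Succ_term (Pair_term (Const 1) (Var 2))) (Var 1) (Const 1)) (Var 3))))))
    (All (Var 1) (All (Var 2) (All (Var 3) (All (Var 4)
      (All (Const 1) (All (Const 1) (All (Const 1) (All (Const 1)
      (Imp (Conj (Mem (fact_term (Var 7) (Var 3) (Var 2)) (Var 8))
          (Conj (Mem (fact_term (Var 6) (Var 1) (Var 0)) (Var 8))
          (Conj (Mem (fact_term (Succ_term (Pair_term (Pair_term (Var 5) (Var 6)) (Var 4)))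
              (Const 2) (Const 0)) (Var 8))
            (Le (Succ_term (Pair_term (Succ_term (Succ_term (Var 5))) (Var 7))) (Var 9)))))
        (Mem (fact_term (Succ_term (Pair_term (Succ_term (Succ_term (Var 5))) (Var 7)))
          (Max_term (Var 3) (Var 1)) (Max_term (Var 2) (Var 0))) (Var 8)))))))))))))))"

lemma holds_closed_form: "holds [S, g] closed_form \<longleftrightarrow> closed_under_rules g (set_decode S)"
  by (simp add: closed_form_def closed_under_rules_def fact_term_def code_fact_def)

text \<open>The variables are, from the outside, start symbol, coded production list, right-hand
  side and remaining productions. A production counts as present when it heads a suffix recorded in
  \<open>S\<close>.\<close>

definition unmixed_form :: aform where
  "unmixed_form = All (Var 1) (All (Var 2) (All (Var 3) (All (Var 4)
    (Imp (Conj (Eq (Var 5) (Pair_term (Var 3) (Var 2)))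
        (Mem (fact_term (Succ_term (Pair_term (Pair_term (Var 3) (Var 1)) (Var 0)))
          (Const 2) (Const 0)) (Var 4)))
      (Neg (Mem (fact_term (Var 1) (Const 1) (Const 1)) (Var 4)))))))"

lemma holds_unmixed_form:
  "holds [S, g] unmixed_form \<longleftrightarrow>
    (\<forall>s\<le>g. \<forall>l\<le>g. \<forall>a\<le>g. \<forall>d\<le>g. g = prod_encode (s, l) \<and>
      code_fact (Suc (prod_encode (prod_encode (s, a), d))) 2 0 \<in> set_decode S \<longrightarrow>
      code_fact a 1 1 \<notin> set_decode S)"
  by (simp add: unmixed_form_def fact_term_def code_fact_def)

section \<open>Soundness and completeness of the facts\<close>

abbreviation code_string :: "symbol list \<Rightarrow> nat" where
  "code_string \<beta> \<equiv> list_encode (map code_symbol \<beta>)"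

text \<open>Letter flags never equal the tag 2, which separates the two kinds of facts.\<close>

lemma of_bool_neq_two: "of_bool P \<noteq> (2::nat)"
  by simp

lemma list_encode_eq_Suc:
  "list_encode xs = Suc (prod_encode (p, c)) \<longleftrightarrow> (\<exists>ys. xs = p # ys \<and> c = list_encode ys)"
  by (cases xs) auto

text \<open>Rule induction. For production suffixes it suffices to remember that all entries code
  productions; the \<open>Nt\<close> rule uses only the head of such a list.\<close>

lemma facts_sound:
  assumes "x \<in> facts (code_cfg \<Gamma>)"
  shows "(\<exists>\<beta> w. x = code_fact (code_string \<beta>) (of_bool (False \<in> set w)) (of_bool (True \<in> set w)) \<and>
      generates \<Gamma> \<beta> w) \<or>
    (\<exists>ps. x = code_fact (list_encode ps) 2 0 \<and> set ps \<subseteq> code_prod ` set (prods \<Gamma>))"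
  using assms
proof (induction rule: facts.induct)
  case (prods s l)
  then show ?case
    by (auto simp: code_cfg_def)
next
  case (tl p c)
  then obtain ps where "list_encode ps = Suc (prod_encode (p, c))"
    "set ps \<subseteq> code_prod ` set (prods \<Gamma>)"
    by (auto simp: of_bool_neq_two)
  then show ?case
    by (auto simp: list_encode_eq_Suc)
next
  case Nil
  show ?case
    using generates.Nil by (intro disjI1 exI[of _ "[]"]) auto
next
  case (Zero c i j)
  then obtain \<beta> w where "c = code_string \<beta>" "j = of_bool (True \<in> set w)" "generates \<Gamma> \<beta> w"
    by auto
  then show ?case
    using generates.Tm[of \<Gamma> \<beta> w False]
    by (intro disjI1 exI[of _ "Tm False # \<beta>"] exI[of _ "False # w"]) auto
next
  case (One c i j)
  then obtain \<beta> w where "c = code_string \<beta>" "i = of_bool (False \<in> set w)" "generates \<Gamma> \<beta> w"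
    by auto
  then show ?case
    using generates.Tm[of \<Gamma> \<beta> w True]
    by (intro disjI1 exI[of _ "Tm True # \<beta>"] exI[of _ "True # w"]) auto
next
  case (Nt c i j a i' j' n d)
  from Nt.IH(1) Nt.hyps obtain \<beta> w where w: "c = code_string \<beta>" "i = of_bool (False \<in> set w)"
    "j = of_bool (True \<in> set w)" "generates \<Gamma> \<beta> w"
    by auto
  from Nt.IH(2) Nt.hyps obtain \<alpha> v where v: "a = code_string \<alpha>" "i' = of_bool (False \<in> set v)"
    "j' = of_bool (True \<in> set v)" "generates \<Gamma> \<alpha> v"
    by auto
  from Nt.IH(3) have "prod_encode (n, a) \<in> code_prod ` set (prods \<Gamma>)"
    by (auto simp: list_encode_eq_Suc of_bool_neq_two eq_commute[of "Suc _" "list_encode _"])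
  \<comment> \<open>Injectivity of the coding identifies the right-hand side coded by
    \<open>a\<close> with \<open>\<alpha>\<close>.\<close>
  then have "(n, \<alpha>) \<in> set (prods \<Gamma>)"
    using v(1) by (auto simp: list_encode_eq inj_map_eq_map[OF inj_code_symbol])
  then have "generates \<Gamma> (Nt n # \<beta>) (v @ w)"
    using v w by (intro generates.Nt)
  then show ?case
    using v w by (intro disjI1 exI[of _ "Nt n # \<beta>"] exI[of _ "v @ w"]) auto
qed

text \<open>The rule \<open>tl\<close> drops productions from the front until \<open>p\<close> heads
  the remaining list.\<close>

lemma facts_production:
  assumes "p \<in> set (prods \<Gamma>)"
  shows "\<exists>d. code_fact (Suc (prod_encode (code_prod p, d))) 2 0 \<in> facts (code_cfg \<Gamma>)"
proof -
  have "code_fact (list_encode zs) 2 0 \<in> facts (code_cfg \<Gamma>)"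
    if "map code_prod (prods \<Gamma>) = ys @ zs" for ys zs
    using that
  proof (induction ys arbitrary: zs rule: rev_induct)
    case Nil
    then show ?case
      by (intro facts.prods) (auto simp: code_cfg_def)
  next
    case (snoc y ys)
    then show ?case
      using facts.tl[of y "list_encode zs"] by simp
  qed
  moreover obtain ys zs where "map code_prod (prods \<Gamma>) = ys @ code_prod p # zs"
    using assms by (metis image_eqI list.set_map split_list)
  ultimately show ?thesis
    by fastforce
qed

lemma code_prod_le:
  assumes "(A, \<alpha>) \<in> set (prods \<Gamma>)"
  shows "A \<le> code_cfg \<Gamma>" "code_string \<alpha> \<le> code_cfg \<Gamma>"
proof -
  obtain d where "code_fact (Suc (prod_encode (code_prod (A, \<alpha>), d))) 2 0 \<in> facts (code_cfg \<Gamma>)"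
    using facts_production[OF assms] by blast
  note prod_encode_le1[OF Suc_leD[OF facts_boundedD[OF this]]]
  then have "prod_encode (A, code_string \<alpha>) \<le> code_cfg \<Gamma>"
    by (simp only: code_prod.simps)
  then show "A \<le> code_cfg \<Gamma>" "code_string \<alpha> \<le> code_cfg \<Gamma>"
    by - (erule prod_encode_le1, erule prod_encode_le2)
qed

text \<open>The restriction to codes below the grammar's code is harmless: it passes to tails, and
  right-hand sides satisfy it by \<open>code_prod_le\<close>.\<close>

lemma facts_complete:
  assumes "generates \<Gamma> \<beta> w" "code_string \<beta> \<le> code_cfg \<Gamma>"
  shows "code_fact (code_string \<beta>) (of_bool (False \<in> set w)) (of_bool (True \<in> set w)) \<in> facts (code_cfg \<Gamma>)"
  using assms
proof (induction rule: generates.induct)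
  case Nil
  show ?case by (simp add: facts.Nil)
next
  case (Tm \<beta> w b)
  have "code_string \<beta> \<le> code_cfg \<Gamma>"
    using Tm.prems prod_encode_le2[of "code_symbol (Tm b)" "code_string \<beta>" "code_cfg \<Gamma>"] by simp
  note IH = Tm.IH[OF this]
  show ?case
    using facts.Zero[OF IH] facts.One[OF IH] Tm.prems by (cases b) auto
next
  case (Nt A \<alpha> v \<beta> w)
  have "code_string \<beta> \<le> code_cfg \<Gamma>"
    using Nt.prems prod_encode_le2[of "code_symbol (Nt A)" "code_string \<beta>" "code_cfg \<Gamma>"] by simp
  note IH = Nt.IH(2)[OF this] Nt.IH(1)[OF code_prod_le(2)[OF Nt.hyps(1)]]
  obtain d where d: "code_fact (Suc (prod_encode (code_prod (A, \<alpha>), d))) 2 0 \<in> facts (code_cfg \<Gamma>)"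
    using facts_production[OF Nt.hyps(1)] by blast
  have max: "of_bool (x \<in> set (v @ w)) = max (of_bool (x \<in> set w)) (of_bool (x \<in> set v) :: nat)" for x
    by (cases "x \<in> set v"; cases "x \<in> set w") simp_all
  have code: "code_string (Nt A # \<beta>) = Suc (prod_encode (Suc (Suc A), code_string \<beta>))"
    by simp
  show ?case
    unfolding max code
    by (rule facts.Nt[OF IH d[unfolded code_prod.simps]]) (use Nt.prems code in simp_all)
qed

text \<open>A mixed word violates the formula by completeness; a violation yields a mixed word by
  soundness.\<close>

lemma holds_unmixed_form_iff:
  "holds [set_encode (facts (code_cfg \<Gamma>)), code_cfg \<Gamma>] unmixed_form \<longleftrightarrow>
    (\<forall>x\<in>lang \<Gamma>. set x \<noteq> {False, True})" (is "?L \<longleftrightarrow> ?R")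
proof
  let ?g = "code_cfg \<Gamma>"
  assume L: ?L
  show ?R
  proof (intro ballI notI)
    fix x assume "x \<in> lang \<Gamma>" and mixed: "set x = {False, True}"
    then obtain \<alpha> where \<alpha>: "(start \<Gamma>, \<alpha>) \<in> set (prods \<Gamma>)" "generates \<Gamma> \<alpha> x"
      by (auto simp: lang_iff_generates)
    obtain d where d: "code_fact (Suc (prod_encode (code_prod (start \<Gamma>, \<alpha>), d))) 2 0 \<in> facts ?g"
      using facts_production[OF \<alpha>(1)] by blast
    obtain l where g: "?g = prod_encode (start \<Gamma>, l)"
      by (simp add: code_cfg_def)
    have l: "l \<le> ?g"
      unfolding g by (rule le_prod_encode_2)
    have d_le: "d \<le> ?g"
      by (rule prod_encode_le2[OF Suc_leD[OF facts_boundedD[OF d]]])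
    have "code_fact (code_string \<alpha>) 1 1 \<in> facts ?g"
      using facts_complete[OF \<alpha>(2) code_prod_le(2)[OF \<alpha>(1)]] mixed by simp
    moreover have "code_fact (code_string \<alpha>) 1 1 \<notin> facts ?g"
      using L[unfolded holds_unmixed_form set_encode_inverse[OF finite_facts], rule_format,
          OF code_prod_le(1)[OF \<alpha>(1)] l code_prod_le(2)[OF \<alpha>(1)] d_le, OF conjI[OF g]] d
      by simp
    ultimately show False by simp
  qed
next
  let ?g = "code_cfg \<Gamma>"
  assume R: ?R
  have unmixed: False if g: "?g = prod_encode (s, l)" and p: "code_fact (Suc (prod_encode (prod_encode (s, a), d))) 2 0 \<in> facts ?g"
    and a: "code_fact a 1 1 \<in> facts ?g" for s l a d
  proof -
    have "prod_encode (s, a) \<in> code_prod ` set (prods \<Gamma>)"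
      using facts_sound[OF p] by (auto simp: list_encode_eq_Suc of_bool_neq_two eq_commute[of "Suc _" "list_encode _"])
    then obtain \<alpha> where \<alpha>: "(s, \<alpha>) \<in> set (prods \<Gamma>)" "a = code_string \<alpha>"
      by auto
    from facts_sound[OF a] obtain \<beta> w where "a = code_string \<beta>" "False \<in> set w" "True \<in> set w"
      "generates \<Gamma> \<beta> w"
      by (auto simp: of_bool_def split: if_splits)
    moreover have "set w = {False, True}"
    proof -
      have "b \<in> set w" for b
        using \<open>False \<in> set w\<close> \<open>True \<in> set w\<close> by (cases b) simp_all
      then show ?thesis by (auto simp flip: UNIV_bool)
    qed
    moreover have "\<beta> = \<alpha>"
      using \<open>a = code_string \<beta>\<close> \<alpha>(2) by (simp add: list_encode_eq inj_map_eq_map[OF inj_code_symbol])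
    moreover have "s = start \<Gamma>"
      using g by (simp add: code_cfg_def)
    ultimately show False
      using R \<alpha> lang_iff_generates by blast
  qed
  show ?L
    unfolding holds_unmixed_form set_encode_inverse[OF finite_facts]
    by (intro allI impI notI, elim conjE) (rule unmixed)
qed

text \<open>The program first searches for the least closed set, which codes exactly the facts, and
  then evaluates \<open>unmixed_form\<close> on it.\<close>

lemma decides_unmixed:
  "\<exists>M. \<forall>\<Gamma>. run M [code_cfg \<Gamma>] = Some (if \<forall>x\<in>lang \<Gamma>. set x \<noteq> {False, True} then 1 else 0)"
proof -
  have "vars_below 2 closed_form" "vars_below 2 unmixed_form"
    by (simp_all add: closed_form_def unmixed_form_def fact_term_def)
  then have c: "computable (Suc 1) (\<lambda>e. of_bool (\<not> holds e closed_form))"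
    and u: "computable (length [0::nat, 1]) (\<lambda>e. of_bool (\<not> holds e unmixed_form))"
    using decidable_holds by (auto simp: decidable_def numeral_2_eq_2)
  define least where "least e = (LEAST S. of_bool (\<not> holds (S # e) closed_form) = (0::nat))" for e
  have least: "least [g] = set_encode (facts g)" for g
    using least_closed_set[of g] by (simp add: least_def holds_closed_form)
  have "computable 1 least"
    unfolding least_def
  proof (rule computable_Mu[OF c])
    fix xs :: "nat list" assume "length xs = 1"
    then obtain g where "xs = [g]" by (auto simp: length_Suc_conv)
    then show "\<exists>S. of_bool (\<not> holds (S # xs) closed_form) = (0::nat)"
      using finite_facts[of g] closed_under_rules_facts[of g]
      by (intro exI[of _ "set_encode (facts g)"]) (simp add: holds_closed_form)
  qed
  \<comment> \<open>The subtraction turns the convention that 0 means true into the required answer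
    1.\<close>
  then have "computable 1 (\<lambda>xs. 1 - of_bool (\<not> holds (map (\<lambda>f. f xs) [least, \<lambda>xs. xs ! 0]) unmixed_form))"
    using u by (intro computable_diff computable_const computable_comp) (auto intro: computable_nth)
  then obtain M where M: "\<And>xs. length xs = 1 \<Longrightarrow>
      run M xs = Some (1 - of_bool (\<not> holds (map (\<lambda>f. f xs) [least, \<lambda>xs. xs ! 0]) unmixed_form))"
    unfolding computable_def by blast
  then show ?thesis
    by (intro exI[of _ M]) (simp add: M least holds_unmixed_form_iff)
qed

theorem mainTheorem7:
  "(\<exists>M. decides_given M (\<lambda>\<Gamma>. zero_one_symmetric (lang \<Gamma>))
          (\<lambda>\<Gamma>. bounded_treewidth (graph_class (lang \<Gamma>)))) \<and>
   (\<exists>M. decides_given M (\<lambda>\<Gamma>. zero_one_symmetric (lang \<Gamma>))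
          (\<lambda>\<Gamma>. bounded_degeneracy (graph_class (lang \<Gamma>))))"
  \<comment> \<open>Both properties amount to the same condition on words, so one program answers
    both questions.\<close>
  using decides_unmixed
  unfolding decides_given_def bounded_treewidth_iff bounded_degeneracy_iff by blast

end
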